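(* Let $n\geq 3$ be an odd integer and let $\Omega=\Omega_1\cup\Omega_2$, where $\Omega_1=\{r^i : 1\le i\le n\}-Z(D_{2n})$ and $\Omega_2=\{sr^i : 1\le i\le n\}$ in the dihedral group $D_{2n}$. Then the non-commuting graph $\Gamma_\Omega$ is a split graph.
   Context: $D_{2n}=\langle r,s : r^n=s^2=1,\ srs=r^{-1}\rangle$ is the dihedral group of order $2n$, and $Z(D_{2n})$ is its center. For a subset $H\subseteq D_{2n}-Z(D_{2n})$, $\Gamma_H$ denotes the simple undirected graph with vertex set $H$ in which two distinct vertices $x,y$ are adjacent if and only if $xy\neq yx$. In particular $\Gamma_\Omega$ with $\Omega=\Omega_1\cup\Omega_2=D_{2n}-Z(D_{2n})$ is the non-commuting graph $\Gamma_{D_{2n}}$ of $D_{2n}$. A graph $\Gamma$ is called split if $V(\Gamma)=S\cup K$, where $S$ is an independent set and $K$ is a complete set (a clique). *)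

theory Defs
  imports "HOL-Algebra.Algebra" "Graph_Theory.Graph_Theory"
begin

section \<open>Groups given by generators and relations\<close>

text \<open>A word is a list of signed letters: \<open>(x, True)\<close> stands for the generator \<open>x\<close> and
  \<open>(x, False)\<close> for its formal inverse. The generators are all elements of the type \<open>'x\<close>.\<close>

type_synonym 'x word = "('x \<times> bool) list"

inductive word_cong :: "('x word \<times> 'x word) set \<Rightarrow> 'x word \<Rightarrow> 'x word \<Rightarrow> bool"
  for R where
  rel: "(u, v) \<in> R \<Longrightarrow> word_cong R u v"
| cancel: "word_cong R [(x, b), (x, \<not> b)] []"
| refl: "word_cong R u u"
| sym: "word_cong R u v \<Longrightarrow> word_cong R v u"
| trans: "word_cong R u v \<Longrightarrow> word_cong R v w \<Longrightarrow> word_cong R u w"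
| append: "word_cong R u u' \<Longrightarrow> word_cong R v v' \<Longrightarrow> word_cong R (u @ v) (u' @ v')"

definition word_class :: "('x word \<times> 'x word) set \<Rightarrow> 'x word \<Rightarrow> 'x word set" where
  "word_class R u = {v. word_cong R u v}"

definition presented_group :: "('x word \<times> 'x word) set \<Rightarrow> 'x word set monoid" where
  "presented_group R =
    \<lparr> carrier = range (word_class R),
      monoid.mult = (\<lambda>A B. \<Union>u\<in>A. \<Union>v\<in>B. word_class R (u @ v)),
      one = word_class R [] \<rparr>"

lemma word_class_eq_iff: "word_class R u = word_class R v \<longleftrightarrow> word_cong R u v"
proof
  assume "word_class R u = word_class R v"
  moreover have "v \<in> word_class R v" by (simp add: word_class_def word_cong.refl)
  ultimately have "v \<in> word_class R u" by simp
  then show "word_cong R u v" by (simp add: word_class_def)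
next
  assume *: "word_cong R u v"
  have "word_cong R u w \<longleftrightarrow> word_cong R v w" for w
    using word_cong.trans[OF *, of w] word_cong.trans[OF word_cong.sym[OF *], of w] by argo
  then show "word_class R u = word_class R v" by (simp add: word_class_def)
qed

lemma carrier_presented_group: "carrier (presented_group R) = range (word_class R)"
  by (simp add: presented_group_def)

lemma word_class_in_carrier: "word_class R u \<in> carrier (presented_group R)"
  by (simp add: carrier_presented_group)

lemma one_presented_group: "\<one>\<^bsub>presented_group R\<^esub> = word_class R []"
  by (simp add: presented_group_def)

lemma mult_presented_group:
  "word_class R u \<otimes>\<^bsub>presented_group R\<^esub> word_class R v = word_class R (u @ v)"
proof -
  have *: "word_class R (u' @ v') = word_class R (u @ v)"
    if "u' \<in> word_class R u" "v' \<in> word_class R v" for u' v'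
    unfolding word_class_eq_iff
  proof (rule word_cong.sym, rule word_cong.append)
    show "word_cong R u u'" "word_cong R v v'" using that by (simp_all add: word_class_def)
  qed
  have "u \<in> word_class R u" "v \<in> word_class R v"
    by (simp_all add: word_class_def word_cong.refl)
  then have "(\<Union>u'\<in>word_class R u. \<Union>v'\<in>word_class R v. word_class R (u' @ v'))
      = word_class R (u @ v)"
    using * by blast
  then show ?thesis by (simp add: presented_group_def)
qed

lemma word_inverse_cong:
  "word_cong R (map (\<lambda>(x, b). (x, \<not> b)) (rev u) @ u) []"
proof (induction u)
  case Nil
  show ?case by (simp add: word_cong.refl)
next
  case (Cons a u)
  obtain x b where a: "a = (x, b)" by (cases a)
  let ?i = "map (\<lambda>(x, b). (x, \<not> b)) (rev u)"
  have "word_cong R [(x, \<not> b), (x, b)] []"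
    using word_cong.cancel[of R x "\<not> b"] by simp
  then have "word_cong R (?i @ ([(x, \<not> b), (x, b)] @ u)) (?i @ ([] @ u))"
    by (intro word_cong.append word_cong.refl)
  then have "word_cong R (?i @ ([(x, \<not> b), (x, b)] @ u)) []"
    by (rule word_cong.trans) (simp add: Cons.IH)
  then show ?case by (simp add: a)
qed

lemma group_presented_group: "group (presented_group R)"
proof (rule groupI)
  show "\<one>\<^bsub>presented_group R\<^esub> \<in> carrier (presented_group R)"
    unfolding one_presented_group by (rule word_class_in_carrier)
next
  fix x assume "x \<in> carrier (presented_group R)"
  then obtain u where u: "x = word_class R u" unfolding carrier_presented_group by (rule rangeE)
  show "\<one>\<^bsub>presented_group R\<^esub> \<otimes>\<^bsub>presented_group R\<^esub> x = x"
    unfolding u mult_presented_group one_presented_group by simp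
  show "\<exists>y\<in>carrier (presented_group R). y \<otimes>\<^bsub>presented_group R\<^esub> x = \<one>\<^bsub>presented_group R\<^esub>"
  proof
    let ?y = "word_class R (map (\<lambda>(x, b). (x, \<not> b)) (rev u))"
    show "?y \<in> carrier (presented_group R)" by (rule word_class_in_carrier)
    show "?y \<otimes>\<^bsub>presented_group R\<^esub> x = \<one>\<^bsub>presented_group R\<^esub>"
      unfolding u mult_presented_group one_presented_group word_class_eq_iff
      by (rule word_inverse_cong)
  qed
  fix y assume "y \<in> carrier (presented_group R)"
  then obtain v where v: "y = word_class R v" unfolding carrier_presented_group by (rule rangeE)
  show "x \<otimes>\<^bsub>presented_group R\<^esub> y \<in> carrier (presented_group R)"
    unfolding u v mult_presented_group by (rule word_class_in_carrier)
  fix z assume "z \<in> carrier (presented_group R)"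
  then obtain w where w: "z = word_class R w" unfolding carrier_presented_group by (rule rangeE)
  show "x \<otimes>\<^bsub>presented_group R\<^esub> y \<otimes>\<^bsub>presented_group R\<^esub> z
      = x \<otimes>\<^bsub>presented_group R\<^esub> (y \<otimes>\<^bsub>presented_group R\<^esub> z)"
    unfolding u v w mult_presented_group by simp
qed

section \<open>The dihedral group\<close>

datatype dihedral_gen = Rot | Refl

text \<open>The relators are \<open>r\<^sup>n = 1\<close>, \<open>s\<^sup>2 = 1\<close> and \<open>s r s = r\<inverse>\<close>.\<close>

definition dihedral_rels :: "nat \<Rightarrow> (dihedral_gen word \<times> dihedral_gen word) set" where
  "dihedral_rels n =
    {(replicate n (Rot, True), []),
     (replicate 2 (Refl, True), []),
     ([(Refl, True), (Rot, True), (Refl, True)], [(Rot, False)])}"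

definition dihedral_group :: "nat \<Rightarrow> dihedral_gen word set monoid" where
  "dihedral_group n = presented_group (dihedral_rels n)"

definition rotation :: "nat \<Rightarrow> dihedral_gen word set" where
  "rotation n = word_class (dihedral_rels n) [(Rot, True)]"

definition reflection :: "nat \<Rightarrow> dihedral_gen word set" where
  "reflection n = word_class (dihedral_rels n) [(Refl, True)]"

definition group_center :: "('a, 'b) monoid_scheme \<Rightarrow> 'a set" where
  "group_center G = {z \<in> carrier G. \<forall>x\<in>carrier G. z \<otimes>\<^bsub>G\<^esub> x = x \<otimes>\<^bsub>G\<^esub> z}"

definition Omega1 :: "nat \<Rightarrow> dihedral_gen word set set" where
  "Omega1 n = {rotation n [^]\<^bsub>dihedral_group n\<^esub> i | i::nat. 1 \<le> i \<and> i \<le> n}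
    - group_center (dihedral_group n)"

definition Omega2 :: "nat \<Rightarrow> dihedral_gen word set set" where
  "Omega2 n =
    {reflection n \<otimes>\<^bsub>dihedral_group n\<^esub> rotation n [^]\<^bsub>dihedral_group n\<^esub> i | i::nat. 1 \<le> i \<and> i \<le> n}"

section \<open>Non-commuting graphs and split graphs\<close>

text \<open>An undirected edge is represented by the two arcs in opposite directions.\<close>

definition noncommuting_graph :: "('a, 'b) monoid_scheme \<Rightarrow> 'a set \<Rightarrow> 'a pair_pre_digraph" where
  "noncommuting_graph G H =
    \<lparr> pverts = H,
      parcs = {(x, y). x \<in> H \<and> y \<in> H \<and> x \<noteq> y \<and> x \<otimes>\<^bsub>G\<^esub> y \<noteq> y \<otimes>\<^bsub>G\<^esub> x} \<rparr>"

definition independent_set :: "('a, 'b) pre_digraph \<Rightarrow> 'a set \<Rightarrow> bool" where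
  "independent_set \<Gamma> S \<longleftrightarrow> S \<subseteq> verts \<Gamma> \<and> (\<forall>x\<in>S. \<forall>y\<in>S. \<not> x \<rightarrow>\<^bsub>\<Gamma>\<^esub> y)"

definition complete_set :: "('a, 'b) pre_digraph \<Rightarrow> 'a set \<Rightarrow> bool" where
  "complete_set \<Gamma> K \<longleftrightarrow> K \<subseteq> verts \<Gamma> \<and> (\<forall>x\<in>K. \<forall>y\<in>K. x \<noteq> y \<longrightarrow> x \<rightarrow>\<^bsub>\<Gamma>\<^esub> y)"

definition split_graph :: "('a, 'b) pre_digraph \<Rightarrow> bool" where
  "split_graph \<Gamma> \<longleftrightarrow>
    (\<exists>S K. verts \<Gamma> = S \<union> K \<and> independent_set \<Gamma> S \<and> complete_set \<Gamma> K)"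

lemma pair_graph_noncommuting_graph:
  assumes "finite H"
  shows "pair_graph (noncommuting_graph G H)"
proof unfold_locales
  let ?\<Gamma> = "noncommuting_graph G H"
  show "fst e \<in> pverts ?\<Gamma>" "snd e \<in> pverts ?\<Gamma>" "fst e \<noteq> snd e" if "e \<in> parcs ?\<Gamma>" for e
    using that by (simp_all add: noncommuting_graph_def case_prod_beta)
  show "finite (pverts ?\<Gamma>)" by (simp add: noncommuting_graph_def assms)
  have "parcs ?\<Gamma> \<subseteq> H \<times> H" unfolding noncommuting_graph_def by clarsimp
  then show "finite (parcs ?\<Gamma>)"
    by (rule finite_subset) (simp add: assms)
  show "symmetric (with_proj ?\<Gamma>)"
    unfolding symmetric_def with_proj_simps by (rule symI) (auto simp: noncommuting_graph_def)
qed

section \<open>Basic facts about the dihedral group\<close>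

lemma group_dihedral_group: "group (dihedral_group n)"
  by (simp add: dihedral_group_def group_presented_group)

lemma dihedral_gens_in_carrier:
  "rotation n \<in> carrier (dihedral_group n)" "reflection n \<in> carrier (dihedral_group n)"
  by (simp_all add: rotation_def reflection_def dihedral_group_def carrier_presented_group)

lemma rotation_pow:
  "rotation n [^]\<^bsub>dihedral_group n\<^esub> (i::nat) = word_class (dihedral_rels n) (replicate i (Rot, True))"
proof (induction i)
  case 0
  show ?case by (simp add: dihedral_group_def one_presented_group)
next
  case (Suc i)
  then show ?case
    unfolding nat_pow_Suc
    by (simp add: rotation_def dihedral_group_def mult_presented_group replicate_append_same)
qed

lemma dihedral_relations:
  "rotation n [^]\<^bsub>dihedral_group n\<^esub> n = \<one>\<^bsub>dihedral_group n\<^esub>"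
  "reflection n \<otimes>\<^bsub>dihedral_group n\<^esub> reflection n = \<one>\<^bsub>dihedral_group n\<^esub>"
  "reflection n \<otimes>\<^bsub>dihedral_group n\<^esub> rotation n \<otimes>\<^bsub>dihedral_group n\<^esub> reflection n = inv\<^bsub>dihedral_group n\<^esub> rotation n"
proof -
  let ?R = "dihedral_rels n"
  have 1: "word_cong ?R (replicate n (Rot, True)) []"
    and 2: "word_cong ?R [(Refl, True), (Refl, True)] []"
    and 3: "word_cong ?R [(Refl, True), (Rot, True), (Refl, True)] [(Rot, False)]"
    by (auto intro!: word_cong.rel simp: dihedral_rels_def numeral_2_eq_2)
  show "rotation n [^]\<^bsub>dihedral_group n\<^esub> n = \<one>\<^bsub>dihedral_group n\<^esub>"
    unfolding rotation_pow using 1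
    by (simp add: dihedral_group_def one_presented_group word_class_eq_iff)
  show "reflection n \<otimes>\<^bsub>dihedral_group n\<^esub> reflection n = \<one>\<^bsub>dihedral_group n\<^esub>"
    using 2 by (simp add: reflection_def dihedral_group_def one_presented_group mult_presented_group
        word_class_eq_iff)
  interpret group "dihedral_group n" by (rule group_dihedral_group)
  have "word_class ?R [(Rot, False)] = inv\<^bsub>dihedral_group n\<^esub> rotation n"
    using word_cong.cancel[of ?R Rot False]
    by (intro inv_equality[symmetric])
      (simp_all add: rotation_def dihedral_group_def mult_presented_group one_presented_group
        word_class_in_carrier word_class_eq_iff)
  with 3 show "reflection n \<otimes>\<^bsub>dihedral_group n\<^esub> rotation n \<otimes>\<^bsub>dihedral_group n\<^esub> reflection n
      = inv\<^bsub>dihedral_group n\<^esub> rotation n"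
    by (simp add: reflection_def rotation_def dihedral_group_def mult_presented_group
        word_class_eq_iff[symmetric])
qed

text \<open>\<open>(a, i)\<close> models \<open>s\<^sup>a r\<^sup>i\<close>; letters act by right multiplication.\<close>

fun dihedral_act :: "dihedral_gen \<times> bool \<Rightarrow> bool \<times> int \<Rightarrow> bool \<times> int" where
  "dihedral_act (Rot, b) (a, i) = (a, if b then i + 1 else i - 1)"
| "dihedral_act (Refl, b) (a, i) = (\<not> a, - i)"

definition dihedral_eqv :: "nat \<Rightarrow> bool \<times> int \<Rightarrow> bool \<times> int \<Rightarrow> bool" where
  "dihedral_eqv n p q \<longleftrightarrow> fst p = fst q \<and> int n dvd snd p - snd q"

lemma dihedral_eqv_refl: "dihedral_eqv n p p"
  by (simp add: dihedral_eqv_def)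

lemma dihedral_eqv_sym: "dihedral_eqv n p q \<Longrightarrow> dihedral_eqv n q p"
  by (auto simp: dihedral_eqv_def dvd_diff_commute)

lemma dihedral_eqv_trans: "dihedral_eqv n p q \<Longrightarrow> dihedral_eqv n q w \<Longrightarrow> dihedral_eqv n p w"
  unfolding dihedral_eqv_def using dvd_add[of "int n" "snd p - snd q" "snd q - snd w"] by simp

lemma dihedral_eqv_act:
  assumes "dihedral_eqv n p q"
  shows "dihedral_eqv n (dihedral_act x p) (dihedral_act x q)"
proof -
  obtain a i where p: "p = (a, i)" by (cases p)
  obtain b j where q: "q = (b, j)" by (cases q)
  obtain g c where x: "x = (g, c)" by (cases x)
  have *: "int n dvd j - i" if "int n dvd i - j" using that by (simp add: dvd_diff_commute)
  show ?thesis using assms *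
    by (cases g) (auto simp: p q x dihedral_eqv_def)
qed

lemma dihedral_eqv_fold:
  "dihedral_eqv n p q \<Longrightarrow> dihedral_eqv n (fold dihedral_act u p) (fold dihedral_act u q)"
proof (induction u arbitrary: p q)
  case (Cons x u)
  show ?case using Cons.IH[OF dihedral_eqv_act[OF Cons.prems, of x]] by simp
qed simp

lemma fold_act_rot:
  "(dihedral_act (Rot, True) ^^ k) (a, i) = (a, i + int k)"
  by (induction k) auto

lemma word_cong_eqv:
  assumes "word_cong (dihedral_rels n) u v"
  shows "dihedral_eqv n (fold dihedral_act u p) (fold dihedral_act v p)"
  using assms
proof (induction arbitrary: p rule: word_cong.induct)
  case (rel u v)
  then show ?case
    by (cases p) (auto simp: dihedral_rels_def fold_act_rot dihedral_eqv_def numeral_2_eq_2)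
next
  case (cancel x b)
  show ?case by (cases p; cases x) (auto simp: dihedral_eqv_def)
next
  case (append u u' v v')
  show ?case
    using dihedral_eqv_trans[OF dihedral_eqv_fold[OF append.IH(1)] append.IH(2)] by simp
next
  case (trans u v w)
  then show ?case by (blast intro: dihedral_eqv_trans)
qed (auto intro: dihedral_eqv_refl dihedral_eqv_sym)

lemma refl_rot_pow:
  "reflection n \<otimes>\<^bsub>dihedral_group n\<^esub> rotation n [^]\<^bsub>dihedral_group n\<^esub> (i::nat)
    = word_class (dihedral_rels n) ((Refl, True) # replicate i (Rot, True))"
  unfolding rotation_pow by (simp add: reflection_def dihedral_group_def mult_presented_group)

context
  fixes n :: nat
  assumes n: "n > 0"
begin

interpretation D: group "dihedral_group n" by (rule group_dihedral_group)

abbreviation (input) rp where "rp (i::nat) \<equiv> rotation n [^]\<^bsub>dihedral_group n\<^esub> i"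
abbreviation (input) srp where "srp (i::nat) \<equiv> reflection n \<otimes>\<^bsub>dihedral_group n\<^esub> rp i"

lemma mem_carrier [simp]:
  "rotation n \<in> carrier (dihedral_group n)" "reflection n \<in> carrier (dihedral_group n)"
  by (rule dihedral_gens_in_carrier)+

lemma rp_mod: "rp i = rp (i mod n)"
proof -
  have "rp i = rp (n * (i div n) + i mod n)" by simp
  also have "\<dots> = rp (n * (i div n)) \<otimes>\<^bsub>dihedral_group n\<^esub> rp (i mod n)"
    by (simp only: D.nat_pow_mult mem_carrier)
  also have "rp (n * (i div n)) = \<one>\<^bsub>dihedral_group n\<^esub>"
    by (simp add: D.nat_pow_pow[symmetric] dihedral_relations(1))
  finally show ?thesis by simp
qed

lemma rp_eq_iff: "rp i = rp j \<longleftrightarrow> i mod n = j mod n"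
proof
  assume "rp i = rp j"
  then have "word_cong (dihedral_rels n) (replicate i (Rot, True)) (replicate j (Rot, True))"
    unfolding rotation_pow word_class_eq_iff .
  from word_cong_eqv[OF this, of "(False, 0)"]
  have "dihedral_eqv n (False, int i) (False, int j)"
    by (simp add: fold_act_rot)
  then have "int i mod int n = int j mod int n"
    by (simp add: dihedral_eqv_def mod_eq_dvd_iff)
  then show "i mod n = j mod n"
    by (metis of_nat_eq_iff of_nat_mod)
next
  assume "i mod n = j mod n"
  then show "rp i = rp j" using rp_mod[of i] rp_mod[of j] by simp
qed

lemma srp_eq_iff: "srp i = srp j \<longleftrightarrow> i mod n = j mod n"
  by (simp add: rp_eq_iff)

lemma rp_neq_srp: "rp i \<noteq> srp j"
proof
  assume "rp i = srp j"
  then have "word_cong (dihedral_rels n) (replicate i (Rot, True))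
      ((Refl, True) # replicate j (Rot, True))"
    unfolding rotation_pow refl_rot_pow[unfolded rotation_pow] word_class_eq_iff .
  from word_cong_eqv[OF this, of "(False, 0)"] show False
    by (simp add: fold_act_rot dihedral_eqv_def)
qed

lemma inv_rotation: "inv\<^bsub>dihedral_group n\<^esub> rotation n = rp (n - 1)"
proof (rule D.inv_equality)
  have "rp (n - 1) \<otimes>\<^bsub>dihedral_group n\<^esub> rotation n = rp (Suc (n - 1))" by simp
  also have "\<dots> = \<one>\<^bsub>dihedral_group n\<^esub>" using n by (simp add: dihedral_relations(1) del: D.nat_pow_Suc)
  finally show "rp (n - 1) \<otimes>\<^bsub>dihedral_group n\<^esub> rotation n = \<one>\<^bsub>dihedral_group n\<^esub>" .
qed auto

lemma rot_refl: "rotation n \<otimes>\<^bsub>dihedral_group n\<^esub> reflection n = srp (n - 1)"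
proof -
  have "srp (n - 1) = reflection n \<otimes>\<^bsub>dihedral_group n\<^esub>
      (reflection n \<otimes>\<^bsub>dihedral_group n\<^esub> rotation n \<otimes>\<^bsub>dihedral_group n\<^esub> reflection n)"
    by (simp add: dihedral_relations(3) inv_rotation)
  also have "\<dots> = (reflection n \<otimes>\<^bsub>dihedral_group n\<^esub> reflection n)
      \<otimes>\<^bsub>dihedral_group n\<^esub> (rotation n \<otimes>\<^bsub>dihedral_group n\<^esub> reflection n)"
    by (simp add: D.m_assoc)
  finally show ?thesis by (simp add: dihedral_relations(2))
qed

lemma rp_refl: "rp i \<otimes>\<^bsub>dihedral_group n\<^esub> reflection n = srp (i * (n - 1))"
proof (induction i)
  case 0
  show ?case by simp
next
  case (Suc i)
  have "rp (Suc i) \<otimes>\<^bsub>dihedral_group n\<^esub> reflection n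
      = rp i \<otimes>\<^bsub>dihedral_group n\<^esub> (rotation n \<otimes>\<^bsub>dihedral_group n\<^esub> reflection n)"
    by (simp add: D.m_assoc)
  also have "\<dots> = rp i \<otimes>\<^bsub>dihedral_group n\<^esub> reflection n \<otimes>\<^bsub>dihedral_group n\<^esub> rp (n - 1)"
    unfolding rot_refl by (simp add: D.m_assoc)
  also have "\<dots> = srp (i * (n - 1) + (n - 1))"
    unfolding Suc by (simp add: D.m_assoc D.nat_pow_mult)
  finally show ?case by (simp add: add.commute)
qed

lemma letter_class:
  "word_class (dihedral_rels n) [(g, b)] =
    (case g of Rot \<Rightarrow> rp (if b then 1 else n - 1) | Refl \<Rightarrow> reflection n)"
proof -
  let ?R = "dihedral_rels n"
  have inv: "word_class ?R [(g, False)] = inv\<^bsub>dihedral_group n\<^esub> word_class ?R [(g, True)]"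
    using word_cong.cancel[of ?R g False]
    by (intro D.inv_equality[symmetric])
      (simp_all add: dihedral_group_def mult_presented_group one_presented_group
        word_class_in_carrier word_class_eq_iff)
  have "inv\<^bsub>dihedral_group n\<^esub> reflection n = reflection n"
    by (rule D.inv_equality) (auto simp: dihedral_relations(2))
  with inv show ?thesis
    by (cases g; cases b)
      (simp_all add: inv_rotation flip: rotation_def reflection_def)
qed

lemma word_class_cases: "\<exists>i. word_class (dihedral_rels n) u \<in> {rp i, srp i}"
proof (induction u rule: rev_induct)
  case Nil
  have "word_class (dihedral_rels n) [] = rp 0"
    by (simp add: dihedral_group_def one_presented_group)
  then show ?case by blast
next
  case (snoc x u)
  obtain g b where x: "x = (g, b)" by (cases x)
  have eq: "word_class (dihedral_rels n) (u @ [x])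
      = word_class (dihedral_rels n) u \<otimes>\<^bsub>dihedral_group n\<^esub> word_class (dihedral_rels n) [x]"
    by (simp add: dihedral_group_def mult_presented_group)
  from snoc obtain i where i: "word_class (dihedral_rels n) u \<in> {rp i, srp i}" by blast
  show ?case
  proof (cases g)
    case Rot
    define k where "k = (if b then 1 else n - 1)"
    have l: "word_class (dihedral_rels n) [x] = rp k"
      unfolding x letter_class k_def Rot by simp
    have "word_class (dihedral_rels n) (u @ [x]) \<in> {rp (i + k), srp (i + k)}"
      using i unfolding eq l by (auto simp: D.m_assoc D.nat_pow_mult)
    then show ?thesis by blast
  next
    case Refl
    have l: "word_class (dihedral_rels n) [x] = reflection n"
      unfolding x letter_class Refl by simp
    define k where "k = i * (n - 1)"
    have rp: "rp i \<otimes>\<^bsub>dihedral_group n\<^esub> reflection n = srp k"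
      unfolding k_def by (rule rp_refl)
    have "srp i \<otimes>\<^bsub>dihedral_group n\<^esub> reflection n
        = reflection n \<otimes>\<^bsub>dihedral_group n\<^esub> srp k"
      using rp by (simp add: D.m_assoc)
    also have "\<dots> = (reflection n \<otimes>\<^bsub>dihedral_group n\<^esub> reflection n) \<otimes>\<^bsub>dihedral_group n\<^esub> rp k"
      by (simp add: D.m_assoc)
    also have "\<dots> = rp k" by (simp add: dihedral_relations(2))
    finally have "word_class (dihedral_rels n) (u @ [x]) \<in> {rp k, srp k}"
      using i rp unfolding eq l by auto
    then show ?thesis by blast
  qed
qed

lemma ex_rp: "\<exists>j. 1 \<le> j \<and> j \<le> n \<and> i mod n = j mod n"
proof (cases "i mod n = 0")
  case True
  then show ?thesis using n by (intro exI[of _ n]) auto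
next
  case False
  then show ?thesis using n by (intro exI[of _ "i mod n"]) (auto simp: less_imp_le)
qed

lemma carrier_dihedral_group:
  "carrier (dihedral_group n) = rp ` {1..n} \<union> srp ` {1..n}"
proof
  show "carrier (dihedral_group n) \<subseteq> rp ` {1..n} \<union> srp ` {1..n}"
  proof
    fix x assume "x \<in> carrier (dihedral_group n)"
    then obtain i where i: "x = rp i \<or> x = srp i"
      using word_class_cases by (fastforce simp: dihedral_group_def carrier_presented_group)
    obtain j where j: "1 \<le> j" "j \<le> n" "i mod n = j mod n" using ex_rp by blast
    then have "rp i = rp j" "srp i = srp j" by (simp_all add: rp_eq_iff)
    with i j show "x \<in> rp ` {1..n} \<union> srp ` {1..n}" by auto
  qed
qed auto

lemma inj_mod: "inj_on (\<lambda>i. i mod n) {1..n}"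
proof (rule inj_onI)
  fix i j assume "i \<in> {1..n}" "j \<in> {1..n}" and eq: "i mod n = j mod n"
  then show "i = j"
    by (cases "i = n"; cases "j = n") auto
qed

lemma order_dihedral_group: "order (dihedral_group n) = 2 * n"
proof -
  have "inj_on rp {1..n}" "inj_on srp {1..n}"
    using inj_mod unfolding inj_on_def rp_eq_iff srp_eq_iff by blast+
  moreover have "rp ` {1..n} \<inter> srp ` {1..n} = {}"
    using rp_neq_srp by blast
  ultimately show ?thesis
    unfolding order_def carrier_dihedral_group by (simp add: card_Un_disjoint card_image)
qed

lemma Omega_eq:
  assumes "n \<ge> 3"
  shows "Omega1 n \<union> Omega2 n = carrier (dihedral_group n) - group_center (dihedral_group n)"
proof -
  have "srp i \<notin> group_center (dihedral_group n)" for i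
  proof
    assume "srp i \<in> group_center (dihedral_group n)"
    then have "srp i \<otimes>\<^bsub>dihedral_group n\<^esub> rotation n = rotation n \<otimes>\<^bsub>dihedral_group n\<^esub> srp i"
      by (simp add: group_center_def)
    also have "\<dots> = srp (n - 1) \<otimes>\<^bsub>dihedral_group n\<^esub> rp i"
      unfolding rot_refl[symmetric] by (simp add: D.m_assoc)
    also have "\<dots> = srp (n - 1 + i)" by (simp add: D.m_assoc D.nat_pow_mult)
    also have "srp i \<otimes>\<^bsub>dihedral_group n\<^esub> rotation n = srp (Suc i)" by (simp add: D.m_assoc)
    finally have "Suc i mod n = (n - 1 + i) mod n" by (simp only: srp_eq_iff)
    then have "n dvd (n - 1 + i) - Suc i"
      using assms by (intro mod_eq_dvd_iff_nat[THEN iffD1]) auto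
    then have "n dvd n - 2" using assms by (simp add: numeral_2_eq_2)
    then show False using assms by (auto dest: dvd_imp_le)
  qed
  then show ?thesis
    unfolding carrier_dihedral_group Omega1_def Omega2_def by auto
qed

end

end

theory Submission
  imports Defs
begin

text \<open>The rotations \<open>r\<^sup>i\<close> are powers of one element, so they commute pairwise and \<open>\<Omega>\<^sub>1\<close> is an
  independent set. For two reflections, \<open>(s r\<^sup>i) (s r\<^sup>j) = r\<^bsup>j - i\<^esup>\<close>, so they commute precisely if
  \<open>r\<^bsup>2 (j - i)\<^esup> = 1\<close>, that is, if \<open>n\<close> divides \<open>2 (j - i)\<close>. When \<open>n\<close> is odd this already forces
  \<open>n\<close> to divide \<open>j - i\<close>, so the two reflections coincide: distinct reflections never commute and
  \<open>\<Omega>\<^sub>2\<close> is a complete set.\<close>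

lemma rotations_commute:
  "rotation n [^]\<^bsub>dihedral_group n\<^esub> (i::nat) \<otimes>\<^bsub>dihedral_group n\<^esub> rotation n [^]\<^bsub>dihedral_group n\<^esub> (j::nat)
    = rotation n [^]\<^bsub>dihedral_group n\<^esub> j \<otimes>\<^bsub>dihedral_group n\<^esub> rotation n [^]\<^bsub>dihedral_group n\<^esub> i"
proof -
  interpret D: group "dihedral_group n" by (rule group_dihedral_group)
  show ?thesis by (simp add: D.nat_pow_mult dihedral_gens_in_carrier add.commute)
qed

text \<open>Both products are classes of explicit words. Equal classes act alike, up to congruence modulo
  \<open>n\<close>, on the normal forms \<open>s\<^sup>a r\<^sup>k\<close>; starting from the normal form of the identity, the two words
  lead to \<open>r\<^bsup>j - i\<^esup>\<close> and \<open>r\<^bsup>i - j\<^esup>\<close>.\<close>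

lemma commuting_reflections_dvd:
  fixes n i j :: nat
  defines "x \<equiv> reflection n \<otimes>\<^bsub>dihedral_group n\<^esub> rotation n [^]\<^bsub>dihedral_group n\<^esub> i"
    and "y \<equiv> reflection n \<otimes>\<^bsub>dihedral_group n\<^esub> rotation n [^]\<^bsub>dihedral_group n\<^esub> j"
  assumes "x \<otimes>\<^bsub>dihedral_group n\<^esub> y = y \<otimes>\<^bsub>dihedral_group n\<^esub> x"
  shows "int n dvd 2 * (int j - int i)"
proof -
  let ?w = "\<lambda>k. (Refl, True) # replicate k (Rot, True)"
  have "word_class (dihedral_rels n) (?w i @ ?w j) = word_class (dihedral_rels n) (?w j @ ?w i)"
    using assms(3) unfolding x_def y_def refl_rot_pow unfolding dihedral_group_def mult_presented_group .
  then have "word_cong (dihedral_rels n) (?w i @ ?w j) (?w j @ ?w i)"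
    by (simp only: word_class_eq_iff)
  from word_cong_eqv[OF this, of "(False, 0)"]
  have "int n dvd (int j - int i) - (int i - int j)"
    by (simp add: fold_act_rot dihedral_eqv_def)
  then show ?thesis by (simp add: algebra_simps)
qed

lemma commuting_reflections_eq:
  fixes n i j :: nat
  defines "x \<equiv> reflection n \<otimes>\<^bsub>dihedral_group n\<^esub> rotation n [^]\<^bsub>dihedral_group n\<^esub> i"
    and "y \<equiv> reflection n \<otimes>\<^bsub>dihedral_group n\<^esub> rotation n [^]\<^bsub>dihedral_group n\<^esub> j"
  assumes "odd n" and commute: "x \<otimes>\<^bsub>dihedral_group n\<^esub> y = y \<otimes>\<^bsub>dihedral_group n\<^esub> x"
  shows "x = y"
proof -
  have "n > 0" using \<open>odd n\<close> by (rule odd_pos)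
  have "int n dvd 2 * (int j - int i)"
    using commute unfolding x_def y_def by (rule commuting_reflections_dvd)
  moreover have "coprime (int n) 2" using \<open>odd n\<close> by simp
  ultimately have "int n dvd int j - int i" by (simp only: coprime_dvd_mult_right_iff)
  then have "int j mod int n = int i mod int n" by (simp add: mod_eq_dvd_iff)
  then have "i mod n = j mod n" by (metis of_nat_eq_iff of_nat_mod)
  then show ?thesis unfolding x_def y_def using srp_eq_iff[OF \<open>n > 0\<close>] by blast
qed

theorem corollary2p5:
  fixes n :: nat
  assumes "n \<ge> 3" and "odd n"
  shows "split_graph (with_proj (noncommuting_graph (dihedral_group n) (Omega1 n \<union> Omega2 n)))"
proof -
  let ?\<Gamma> = "with_proj (noncommuting_graph (dihedral_group n) (Omega1 n \<union> Omega2 n))"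
  have "verts ?\<Gamma> = Omega1 n \<union> Omega2 n" by (simp add: noncommuting_graph_def)
  moreover have "independent_set ?\<Gamma> (Omega1 n)"
    unfolding independent_set_def Omega1_def
    by (auto simp: noncommuting_graph_def rotations_commute)
  moreover have "complete_set ?\<Gamma> (Omega2 n)"
  proof -
    have "x \<otimes>\<^bsub>dihedral_group n\<^esub> y \<noteq> y \<otimes>\<^bsub>dihedral_group n\<^esub> x"
      if "x \<in> Omega2 n" "y \<in> Omega2 n" "x \<noteq> y" for x y
      using that commuting_reflections_eq[OF \<open>odd n\<close>] unfolding Omega2_def by blast
    then show ?thesis by (simp add: complete_set_def noncommuting_graph_def)
  qed
  ultimately show ?thesis unfolding split_graph_def by blast
qed

end
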